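(* Let $N,n,R\in\mathbb{N}$ with $N=nR$ and $R\ge 2$, let $y_1,\dots,y_N\in\mathbb{R}$, $\sigma>0$ and $0<h<2$. Let $(x_k)_{k\ge 0}$ be defined by $x_0=0$ and $$x_{k+1}=(1-h)x_k+h\widehat{y}_k+\sigma\sqrt{\frac{2h}{N}}\,\xi_k,\qquad \xi_k\sim\mathcal{N}(0,1)\ \text{i.i.d.},$$ where $(\widehat{y}_k)_{k\ge0}$ are the batch means generated by Random Reshuffling, and let $V$ be the (common) variance of $\widehat{y}_k$. Then for each $r\in\{0,\dots,R-1\}$ the limit $\mathbb{V}[x_\infty^{(r)}]:=\lim_{n_e\to\infty}\mathbb{V}[x_{n_eR+r}]$ satisfies $$\frac{\mathbb{V}[x^{(r)}_{\infty}]-\sigma^{2}/N}{\sigma^{2}/N}=\frac{NV}{\sigma^2(R-1)}\left[\frac{Rh}{2-h}-\left(\frac{(1-h)^{2r}\left(1-(1-h)^R\right)^2}{1-(1-h)^{2R}}+\left(1-(1-h)^r\right)^2\right)\right]+\frac{2}{2-h}-1 .$$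
   Context: This recursion is Stochastic Gradient Langevin Dynamics (after rescaling the step size $h\leftarrow\sigma^2h/N$) for the Gaussian target $\mathcal{N}(\bar y,\sigma^2/N)$ with $\bar y=\frac1N\sum_{i=1}^N y_i$. Random Reshuffling: for each epoch $l=0,1,2,\dots$, a uniformly random permutation of $\{1,\dots,N\}$ is drawn, independently across epochs, and cut into $R$ successive blocks of length $n$, denoted $\boldsymbol{\omega}_{lR},\dots,\boldsymbol{\omega}_{lR+R-1}$, which partition $\{1,\dots,N\}$. Then $\widehat{y}_k=\frac1n\sum_{j=1}^n y_{\omega_{k,j}}$, where $\boldsymbol{\omega}_k=(\omega_{k,1},\dots,\omega_{k,n})$. The noises $(\xi_k)$ are independent of the permutations. $\mathbb{V}$ denotes variance; $V=\mathbb{V}[\widehat{y}_k]$ does not depend on $k$. The convention $(1-h)^0=1$ is used. *)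

theory Defs
  imports "HOL-Probability.Probability" "HOL-Combinatorics.Permutations"
begin

definition perms :: "nat \<Rightarrow> (nat \<Rightarrow> nat) set" where
  "perms N = {p. p permutes {1..N}}"

definition random_reshuffling ::
  "'a measure \<Rightarrow> nat \<Rightarrow> (nat \<Rightarrow> 'a \<Rightarrow> nat \<Rightarrow> nat) \<Rightarrow> bool" where
  "random_reshuffling M N \<pi> \<longleftrightarrow>
     prob_space.indep_vars M (\<lambda>_. count_space (perms N)) \<pi> UNIV \<and>
     (\<forall>l. distr M (count_space (perms N)) (\<pi> l) = uniform_count_measure (perms N))"

(* Step k = l * R + b with b < R uses the b-th block of the permutation of epoch l, that is,
   the positions b * n + 1, ..., b * n + n. *)
definition batch_index ::
  "nat \<Rightarrow> nat \<Rightarrow> (nat \<Rightarrow> 'a \<Rightarrow> nat \<Rightarrow> nat) \<Rightarrow> nat \<Rightarrow> nat \<Rightarrow> 'a \<Rightarrow> nat" where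
  "batch_index n R \<pi> k j \<omega> = \<pi> (k div R) \<omega> ((k mod R) * n + j)"

definition batch_mean ::
  "nat \<Rightarrow> nat \<Rightarrow> (nat \<Rightarrow> real) \<Rightarrow> (nat \<Rightarrow> 'a \<Rightarrow> nat \<Rightarrow> nat) \<Rightarrow> nat \<Rightarrow> 'a \<Rightarrow> real" where
  "batch_mean n R y \<pi> k \<omega> = 1 / real n * (\<Sum>j=1..n. y (batch_index n R \<pi> k j \<omega>))"

definition iid_std_normal :: "'a measure \<Rightarrow> (nat \<Rightarrow> 'a \<Rightarrow> real) \<Rightarrow> bool" where
  "iid_std_normal M \<xi> \<longleftrightarrow>
     prob_space.indep_vars M (\<lambda>_. borel) \<xi> UNIV \<and>
     (\<forall>k. distributed M lborel (\<xi> k) std_normal_density)"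

(* Independence of the two whole sequences, expressed through the sigma-algebras they generate;
   the library's indep_var is restricted to random variables of the same type. *)
definition noise_indep_of_permutations ::
  "'a measure \<Rightarrow> nat \<Rightarrow> (nat \<Rightarrow> 'a \<Rightarrow> nat \<Rightarrow> nat) \<Rightarrow> (nat \<Rightarrow> 'a \<Rightarrow> real) \<Rightarrow> bool" where
  "noise_indep_of_permutations M N \<pi> \<xi> \<longleftrightarrow>
     prob_space.indep_set M
       (sets (vimage_algebra (space M) (\<lambda>\<omega> l. \<pi> l \<omega>) (\<Pi>\<^sub>M l\<in>UNIV. count_space (perms N))))
       (sets (vimage_algebra (space M) (\<lambda>\<omega> k. \<xi> k \<omega>) (\<Pi>\<^sub>M k\<in>UNIV. borel)))"

end

theory Submission
  imports Defs
begin

text \<open>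
  Solving the recursion writes \<open>x\<^sub>k\<close> as a weighted sum of the batch means and of the noises. After
  centering, the contribution of each epoch and each noise term are pairwise uncorrelated, so their
  variances add up. Within an epoch, exchangeability makes the covariance of two distinct entries of
  the random permutation a constant, and since all entries have a deterministic sum, this constant
  is minus the variance divided by \<open>N - 1\<close>. Hence the weights \<open>d\<^sub>b\<close> of an epoch contribute
  \<open>V / (R - 1) * (R * \<Sum>d\<^sub>b\<^sup>2 - (\<Sum>d\<^sub>b)\<^sup>2)\<close>. All weights are geometric, and the bracket of the theorem
  collects the limits of the three kinds of terms: the squares of all weights, the squared weight sums
  of the full epochs, and that of the last, partial epoch.
\<close>

subsection \<open>Sums over permutations\<close>

lemma sum_blocks:
  fixes f :: "nat \<Rightarrow> 'b::comm_monoid_add"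
  shows "(\<Sum>i=1..n * R. f i) = (\<Sum>b<R. \<Sum>j=1..n. f (b * n + j))"
proof (induction R)
  case (Suc R)
  have "(\<Sum>i=1..n * R + n. f i) = (\<Sum>i=1..n * R. f i) + (\<Sum>i=n * R + 1..n * R + n. f i)"
    by (rule sum.ub_add_nat) simp
  also have "(\<Sum>i=n * R + 1..n * R + n. f i) = (\<Sum>j=1..n. f (R * n + j))"
    using sum.shift_bounds_cl_nat_ivl[of f 1 "n * R" n] by (simp add: ac_simps)
  finally show ?case using Suc.IH by (simp add: ac_simps)
qed simp

lemma finite_perms: "finite (perms N)"
  by (simp add: perms_def finite_permutations)

lemma card_perms: "card (perms N) = fact N"
  by (simp add: perms_def card_permutations)

text \<open>Composing every permutation with the transposition of \<open>i\<close> and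
  \<open>i'\<close> only reorders the sum, so no position is distinguished.\<close>

lemma sum_perms_single_eq:
  fixes g :: "nat \<Rightarrow> real"
  assumes "i \<in> {1..N}" "i' \<in> {1..N}"
  shows "(\<Sum>p\<in>perms N. g (p i)) = (\<Sum>p\<in>perms N. g (p i'))"
proof -
  have q: "Transposition.transpose i i' permutes {1..N}" using assms by (rule permutes_swap_id)
  show ?thesis
    unfolding perms_def by (subst sum_permutations_compose_right[OF q]) simp
qed

text \<open>The symmetric group acts transitively on ordered pairs of distinct positions. A
  permutation \<open>q\<close> with \<open>q i = i'\<close> and \<open>q j = j'\<close> is built,
  and the right-hand sum is reindexed by composition with \<open>inv q\<close>.\<close>

lemma sum_perms_pair_eq:
  fixes g :: "nat \<Rightarrow> nat \<Rightarrow> real"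
  assumes "i \<in> {1..N}" "j \<in> {1..N}" "i \<noteq> j" "i' \<in> {1..N}" "j' \<in> {1..N}" "i' \<noteq> j'"
  shows "(\<Sum>p\<in>perms N. g (p i) (p j)) = (\<Sum>p\<in>perms N. g (p i') (p j'))"
proof -
  define k where "k = Transposition.transpose i i' j"
  \<comment> \<open>The first swap sends \<open>i\<close> to \<open>i'\<close> and \<open>j\<close>
    to \<open>k\<close>; the second sends \<open>k\<close> to \<open>j'\<close> and leaves
    \<open>i'\<close> alone, because \<open>i'\<close> differs from both \<open>k\<close> and
    \<open>j'\<close>.\<close>
  define q where "q = Transposition.transpose k j' \<circ> Transposition.transpose i i'"
  have k: "k \<in> {1..N}" "k \<noteq> i'" using assms by (auto simp: k_def Transposition.transpose_def)
  have q: "q permutes {1..N}" unfolding q_def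
    using assms k by (intro permutes_compose permutes_swap_id) auto
  have "q i = i'" "q j = j'"
    using k assms(6) by (auto simp: q_def Transposition.transpose_def k_def[symmetric]) (auto simp: k_def Transposition.transpose_def)
  then have "inv q i' = i" "inv q j' = j" by (simp_all add: permutes_inv_eq[OF q])
  then show ?thesis
    unfolding perms_def by (subst (2) sum_permutations_compose_right[OF permutes_inv[OF q]]) simp
qed

lemma sum_permuted:
  assumes "p \<in> perms N"
  shows "(\<Sum>i=1..N. z (p i)) = (\<Sum>i=1..N. z i)"
  using sum.permute[of p "{1..N}" z] assms by (simp add: perms_def o_def)

text \<open>By exchangeability all \<open>N\<close> positions give the same sum. Added over all
  positions, each permutation contributes the total of \<open>z\<close>, which is zero.\<close>

lemma sum_perms_centered:
  fixes z :: "nat \<Rightarrow> real"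
  assumes "(\<Sum>i=1..N. z i) = 0" "i \<in> {1..N}"
  shows "(\<Sum>p\<in>perms N. z (p i)) = 0"
proof -
  have "(\<Sum>i'=1..N. \<Sum>p\<in>perms N. z (p i')) = (\<Sum>i'=1..N. \<Sum>p\<in>perms N. z (p i))"
    using assms(2) by (intro sum.cong refl sum_perms_single_eq)
  then have "real N * (\<Sum>p\<in>perms N. z (p i)) = (\<Sum>i'=1..N. \<Sum>p\<in>perms N. z (p i'))"
    by simp
  also have "\<dots> = (\<Sum>p\<in>perms N. \<Sum>i'=1..N. z (p i'))" by (rule sum.swap)
  also have "\<dots> = 0" by (simp add: sum_permuted assms(1) del: One_nat_def)
  finally show ?thesis using assms(2) by auto
qed

lemma sum_perms_product_centered:
  fixes z :: "nat \<Rightarrow> real"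
  assumes z: "(\<Sum>i=1..N. z i) = 0"
  obtains K where "\<And>i j. i \<in> {1..N} \<Longrightarrow> j \<in> {1..N} \<Longrightarrow>
    (\<Sum>p\<in>perms N. z (p i) * z (p j)) = K * ((if i = j then real N else 0) - 1)"
proof -
  define T where "T i j = (\<Sum>p\<in>perms N. z (p i) * z (p j))" for i j
  \<comment> \<open>\<open>K\<close> is the common off-diagonal value with its sign reversed. If
    \<open>N = 1\<close> there is no off-diagonal pair and the value of \<open>K\<close> is
    irrelevant, since the diagonal factor \<open>N - 1\<close> vanishes.\<close>
  define K where "K = - T 1 2"
  have off: "T i j = - K" if "i \<in> {1..N}" "j \<in> {1..N}" "i \<noteq> j" for i j
  proof -
    have "N \<ge> 2" using that by auto
    then show ?thesis unfolding K_def T_def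
      using sum_perms_pair_eq[of i N j 1 2 "\<lambda>a b. z a * z b"] that by simp
  qed
  have diag: "T i i = K * (real N - 1)" if i: "i \<in> {1..N}" for i
  proof -
    \<comment> \<open>Every row of \<open>T\<close> sums to zero, because the entries of a permuted
      centered vector do. The diagonal entry therefore cancels \<open>N - 1\<close> equal
      off-diagonal ones.\<close>
    have "(\<Sum>j=1..N. T i j) = (\<Sum>p\<in>perms N. z (p i) * (\<Sum>j=1..N. z (p j)))"
      unfolding T_def sum_distrib_left by (rule sum.swap)
    also have "\<dots> = 0" by (simp add: sum_permuted z del: One_nat_def)
    finally have "T i i + (\<Sum>j\<in>{1..N} - {i}. T i j) = 0"
      using i by (subst (asm) sum.remove[of _ i]) auto
    moreover have "(\<Sum>j\<in>{1..N} - {i}. T i j) = (\<Sum>j\<in>{1..N} - {i}. - K)"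
      using off[OF i] by (intro sum.cong) auto
    ultimately show ?thesis using i by (simp add: of_nat_diff algebra_simps)
  qed
  show ?thesis
    by (rule that[of K]) (use off diag in \<open>auto simp: T_def\<close>)
qed

text \<open>The matrix of second moments is \<open>K\<close> times (\<open>N\<close> times the
  identity minus the all-ones matrix). Its quadratic form in \<open>w\<close> consists of a sum of
  squares and the square of the sum. The same \<open>K\<close> serves all weights.\<close>

lemma sum_perms_weighted_square:
  fixes z :: "nat \<Rightarrow> real"
  assumes z: "(\<Sum>i=1..N. z i) = 0"
  obtains K where "\<And>w. (\<Sum>p\<in>perms N. (\<Sum>i=1..N. w i * z (p i))\<^sup>2) =
    K * (real N * (\<Sum>i=1..N. (w i)\<^sup>2) - (\<Sum>i=1..N. w i)\<^sup>2)"
proof -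
  obtain K where K: "\<And>i j. i \<in> {1..N} \<Longrightarrow> j \<in> {1..N} \<Longrightarrow>
    (\<Sum>p\<in>perms N. z (p i) * z (p j)) = K * ((if i = j then real N else 0) - 1)"
    using sum_perms_product_centered[OF z] by blast
  show ?thesis
  proof (rule that[of K])
    fix w :: "nat \<Rightarrow> real"
    have "(\<Sum>p\<in>perms N. (\<Sum>i=1..N. w i * z (p i))\<^sup>2)
        = (\<Sum>p\<in>perms N. \<Sum>i=1..N. \<Sum>j=1..N. w i * w j * (z (p i) * z (p j)))"
      by (simp add: power2_eq_square sum_product ac_simps)
    also have "\<dots> = (\<Sum>i=1..N. \<Sum>p\<in>perms N. \<Sum>j=1..N. w i * w j * (z (p i) * z (p j)))"
      by (rule sum.swap)
    also have "\<dots> = (\<Sum>i=1..N. \<Sum>j=1..N. w i * w j * (\<Sum>p\<in>perms N. z (p i) * z (p j)))"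
      by (subst sum.swap) (simp add: sum_distrib_left)
    also have "\<dots> = (\<Sum>i=1..N. \<Sum>j=1..N.
        (if i = j then K * real N * (w i * w j) else 0) - K * (w i * w j))"
      by (intro sum.cong refl) (auto simp: K algebra_simps)
    also have "\<dots> = (\<Sum>i=1..N. K * real N * (w i)\<^sup>2) - (\<Sum>i=1..N. \<Sum>j=1..N. K * (w i * w j))"
      by (simp add: sum_subtractf power2_eq_square)
    also have "(\<Sum>i=1..N. \<Sum>j=1..N. K * (w i * w j)) = K * (\<Sum>i=1..N. w i)\<^sup>2"
      unfolding power2_eq_square sum_product by (simp only: sum_distrib_left)
    finally show "(\<Sum>p\<in>perms N. (\<Sum>i=1..N. w i * z (p i))\<^sup>2) =
      K * (real N * (\<Sum>i=1..N. (w i)\<^sup>2) - (\<Sum>i=1..N. w i)\<^sup>2)"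
      by (simp add: sum_distrib_left algebra_simps)
  qed
qed

text \<open>Weighting block means by \<open>d\<close> amounts to giving each entry of block
  \<open>b\<close> the weight \<open>d b / n\<close>. The squares of these weights add up to the sum
  of the squares of \<open>d\<close> divided by \<open>n\<close>, which turns the factor
  \<open>n * R\<close> into \<open>R\<close>.\<close>

lemma sum_perms_weighted_blocks_square:
  fixes z :: "nat \<Rightarrow> real"
  assumes z: "(\<Sum>i=1..n * R. z i) = 0" and n: "n \<ge> 1"
  obtains K where "\<And>d. (\<Sum>p\<in>perms (n * R). (\<Sum>b<R. d b * (1 / real n * (\<Sum>j=1..n. z (p (b * n + j)))))\<^sup>2) =
    K * (real R * (\<Sum>b<R. (d b)\<^sup>2) - (\<Sum>b<R. d b)\<^sup>2)"
proof -
  obtain K where K: "\<And>w. (\<Sum>p\<in>perms (n * R). (\<Sum>i=1..n * R. w i * z (p i))\<^sup>2) =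
    K * (real (n * R) * (\<Sum>i=1..n * R. (w i)\<^sup>2) - (\<Sum>i=1..n * R. w i)\<^sup>2)"
    using sum_perms_weighted_square[OF z] by blast
  show ?thesis
  proof (rule that[of K])
    fix d :: "nat \<Rightarrow> real"
    \<comment> \<open>Positions start at 1, so block \<open>b\<close> holds the positions
      \<open>b * n + 1\<close> to \<open>b * n + n\<close>; subtracting 1 before dividing makes the
      last of them belong to block \<open>b\<close> as well.\<close>
    define w where "w i = d ((i - 1) div n) / real n" for i
    have w: "w (b * n + j) = d b / real n" if "j \<in> {1..n}" for b j
    proof -
      have "b * n + j - 1 = (j - 1) + b * n" using that by auto
      moreover have "(j - 1 + b * n) div n = b" using that n by (subst div_mult_self1) auto
      ultimately show ?thesis by (simp add: w_def)
    qed
    have "(\<Sum>i=1..n * R. w i * z (p i)) = (\<Sum>b<R. d b * (1 / real n * (\<Sum>j=1..n. z (p (b * n + j)))))" for p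
      unfolding sum_blocks by (simp add: w sum_distrib_left)
    moreover have "(\<Sum>i=1..n * R. w i) = (\<Sum>b<R. d b)"
      unfolding sum_blocks using n by (simp add: w)
    moreover have "real (n * R) * (\<Sum>i=1..n * R. (w i)\<^sup>2) = real R * (\<Sum>b<R. (d b)\<^sup>2)"
      unfolding sum_blocks using n
      by (simp add: w sum_distrib_left power_divide power2_eq_square)
    ultimately show "(\<Sum>p\<in>perms (n * R). (\<Sum>b<R. d b * (1 / real n * (\<Sum>j=1..n. z (p (b * n + j)))))\<^sup>2) =
      K * (real R * (\<Sum>b<R. (d b)\<^sup>2) - (\<Sum>b<R. d b)\<^sup>2)"
      using K[of w] by simp
  qed
qed

subsection \<open>Variance of weighted batch means and noises\<close>

lemma sum_nat_blocks:
  fixes f :: "nat \<Rightarrow> 'b::comm_monoid_add"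
  shows "(\<Sum>i<L * R. f i) = (\<Sum>l<L. \<Sum>b<R. f (l * R + b))"
proof -
  have "(\<Sum>i=l * R..<l * R + R. f i) = (\<Sum>b<R. f (l * R + b))" for l
    using sum.shift_bounds_nat_ivl[of f 0 "l * R" R] by (simp add: atLeast0LessThan ac_simps)
  then show ?thesis by (simp flip: sum.nat_group)
qed

context prob_space
begin

lemma expectation_sum_uncorrelated_square:
  fixes X :: "'i \<Rightarrow> 'a \<Rightarrow> real"
  assumes fin: "finite I"
    and int: "\<And>i j. i \<in> I \<Longrightarrow> j \<in> I \<Longrightarrow> integrable M (\<lambda>\<omega>. X i \<omega> * X j \<omega>)"
    and unc: "\<And>i j. i \<in> I \<Longrightarrow> j \<in> I \<Longrightarrow> i \<noteq> j \<Longrightarrow> expectation (\<lambda>\<omega>. X i \<omega> * X j \<omega>) = 0"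
  shows "expectation (\<lambda>\<omega>. (\<Sum>i\<in>I. X i \<omega>)\<^sup>2) = (\<Sum>i\<in>I. expectation (\<lambda>\<omega>. (X i \<omega>)\<^sup>2))"
proof -
  have "expectation (\<lambda>\<omega>. (\<Sum>i\<in>I. X i \<omega>)\<^sup>2) = (\<Sum>i\<in>I. \<Sum>j\<in>I. expectation (\<lambda>\<omega>. X i \<omega> * X j \<omega>))"
    unfolding power2_eq_square sum_product
    by (subst Bochner_Integration.integral_sum, auto intro!: int Bochner_Integration.integrable_sum)
      (auto intro!: sum.cong Bochner_Integration.integral_sum int)
  also have "\<dots> = (\<Sum>i\<in>I. \<Sum>j\<in>I. if i = j then expectation (\<lambda>\<omega>. X i \<omega> * X i \<omega>) else 0)"
    by (intro sum.cong refl) (simp add: unc)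
  finally show ?thesis by (simp add: fin power2_eq_square)
qed

lemma expectation_mult_zero_mean:
  fixes X Y :: "'a \<Rightarrow> real"
  assumes "indep_var borel X borel Y" "integrable M X" "integrable M Y" "expectation Y = 0"
  shows "integrable M (\<lambda>\<omega>. X \<omega> * Y \<omega>)" "expectation (\<lambda>\<omega>. X \<omega> * Y \<omega>) = 0"
  using indep_var_integrable[OF assms(1-3)] indep_var_lebesgue_integral[OF assms(1-3)] assms(4) by auto

lemma indep_vars_imp_indep_var:
  assumes X: "indep_vars (\<lambda>_. N) X UNIV" and "i \<noteq> j"
  shows "indep_var N (X i) N (X j)"
proof -
  have "indep_var (PiM {i} (\<lambda>_. N)) (\<lambda>\<omega>. restrict (\<lambda>k. X k \<omega>) {i}) (PiM {j} (\<lambda>_. N)) (\<lambda>\<omega>. restrict (\<lambda>k. X k \<omega>) {j})"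
    using assms by (intro indep_var_restrict) auto
  then have "indep_var N ((\<lambda>f. f i) \<circ> (\<lambda>\<omega>. restrict (\<lambda>k. X k \<omega>) {i})) N ((\<lambda>f. f j) \<circ> (\<lambda>\<omega>. restrict (\<lambda>k. X k \<omega>) {j}))"
    by (rule indep_var_compose) (auto intro!: measurable_component_singleton)
  then show ?thesis by (simp add: o_def)
qed

section \<open>Integrals and independence of functions of the random permutations\<close>

lemma random_reshuffling_measurable:
  assumes "random_reshuffling M N \<pi>"
  shows "\<pi> l \<in> measurable M (count_space (perms N))"
  using assms unfolding random_reshuffling_def indep_vars_def by auto

lemma random_reshuffling_integrable:
  fixes f :: "(nat \<Rightarrow> nat) \<Rightarrow> real"
  assumes "random_reshuffling M N \<pi>"
  shows "integrable M (\<lambda>\<omega>. f (\<pi> l \<omega>))"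
proof (rule integrable_const_bound[where B="\<Sum>p\<in>perms N. \<bar>f p\<bar>"])
  note \<pi> = random_reshuffling_measurable[OF assms, of l]
  show "AE \<omega> in M. norm (f (\<pi> l \<omega>)) \<le> (\<Sum>p\<in>perms N. \<bar>f p\<bar>)"
    using measurable_space[OF \<pi>]
    by (intro AE_I2) (auto intro!: member_le_sum finite_perms)
  show "(\<lambda>\<omega>. f (\<pi> l \<omega>)) \<in> borel_measurable M"
    by (rule measurable_compose[OF \<pi>]) simp
qed

lemma random_reshuffling_expectation:
  fixes f :: "(nat \<Rightarrow> nat) \<Rightarrow> real"
  assumes "random_reshuffling M N \<pi>"
  shows "expectation (\<lambda>\<omega>. f (\<pi> l \<omega>)) = (\<Sum>p\<in>perms N. f p) / fact N"
proof -
  have "expectation (\<lambda>\<omega>. f (\<pi> l \<omega>)) = integral\<^sup>L (distr M (count_space (perms N)) (\<pi> l)) f"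
    by (rule integral_distr[symmetric, OF random_reshuffling_measurable[OF assms]]) simp
  also have "\<dots> = integral\<^sup>L (uniform_count_measure (perms N)) f"
    using assms by (simp add: random_reshuffling_def)
  finally show ?thesis by (simp add: integral_uniform_count_measure finite_perms card_perms)
qed

lemma random_reshuffling_indep:
  fixes f :: "nat \<Rightarrow> (nat \<Rightarrow> nat) \<Rightarrow> real"
  assumes "random_reshuffling M N \<pi>" "l \<noteq> l'"
  shows "indep_var borel (\<lambda>\<omega>. f l (\<pi> l \<omega>)) borel (\<lambda>\<omega>. f l' (\<pi> l' \<omega>))"
proof -
  have "indep_vars (\<lambda>_. count_space (perms N)) \<pi> UNIV"
    using assms(1) by (simp add: random_reshuffling_def)
  then have "indep_vars (\<lambda>_. borel) (\<lambda>l \<omega>. f l (\<pi> l \<omega>)) UNIV"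
    by (rule indep_vars_compose2) simp
  then show ?thesis using assms(2) by (rule indep_vars_imp_indep_var)
qed

text \<open>Independence passes to smaller sigma-algebras: a function of one permutation is
  measurable for the sigma-algebra of the whole permutation sequence, and one noise for that of the
  whole noise sequence.\<close>

lemma random_reshuffling_noise_indep:
  fixes f :: "(nat \<Rightarrow> nat) \<Rightarrow> real"
  assumes \<pi>: "random_reshuffling M N \<pi>" and \<xi>: "iid_std_normal M \<xi>"
    and indep: "noise_indep_of_permutations M N \<pi> \<xi>"
  shows "indep_var borel (\<lambda>\<omega>. f (\<pi> l \<omega>)) borel (\<xi> k)"
proof -
  let ?P = "vimage_algebra (space M) (\<lambda>\<omega> l. \<pi> l \<omega>) (\<Pi>\<^sub>M l\<in>UNIV. count_space (perms N))"
  let ?X = "vimage_algebra (space M) (\<lambda>\<omega> k. \<xi> k \<omega>) (\<Pi>\<^sub>M k\<in>UNIV. (borel :: real measure))"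
  have \<xi>k: "\<xi> k \<in> borel_measurable M" for k
    using \<xi> unfolding iid_std_normal_def indep_vars_def by auto
  have f\<pi>: "(\<lambda>\<omega>. f (\<pi> l \<omega>)) \<in> borel_measurable M"
    by (rule measurable_compose[OF random_reshuffling_measurable[OF \<pi>]]) simp
  have "(\<lambda>\<omega> l. \<pi> l \<omega>) \<in> measurable ?P (\<Pi>\<^sub>M l\<in>UNIV. count_space (perms N))"
    using measurable_space[OF random_reshuffling_measurable[OF \<pi>]]
    by (intro measurable_vimage_algebra1) (auto simp: space_PiM PiE_def)
  then have "\<pi> l \<in> measurable ?P (count_space (perms N))"
    by (rule measurable_compose[OF _ measurable_component_singleton]) simp
  then have 1: "(\<lambda>\<omega>. f (\<pi> l \<omega>)) \<in> borel_measurable ?P"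
    by (rule measurable_compose) simp
  have "(\<lambda>\<omega> k. \<xi> k \<omega>) \<in> measurable ?X (\<Pi>\<^sub>M k\<in>UNIV. borel)"
    by (intro measurable_vimage_algebra1) (auto simp: space_PiM PiE_def)
  then have 2: "\<xi> k \<in> borel_measurable ?X"
    by (rule measurable_compose[OF _ measurable_component_singleton]) simp
  have sub: "sigma_sets (space M) {Z -` A \<inter> space M |A. A \<in> sets borel} \<subseteq> sets F"
    if "Z \<in> borel_measurable F" "space F = space M" for Z :: "'a \<Rightarrow> real" and F
    unfolding that(2)[symmetric]
    using measurable_sets[OF that(1)] by (intro sets.sigma_sets_subset) auto
  have "indep_set (sets ?P) (sets ?X)"
    using indep by (simp add: noise_indep_of_permutations_def)
  moreover have "sigma_sets (space M) {(\<lambda>\<omega>. f (\<pi> l \<omega>)) -` A \<inter> space M |A. A \<in> sets borel} \<subseteq> sets ?P"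
    using 1 by (rule sub) simp
  moreover have "sigma_sets (space M) {\<xi> k -` A \<inter> space M |A. A \<in> sets borel} \<subseteq> sets ?X"
    using 2 by (rule sub) simp
  ultimately have "indep_set (sigma_sets (space M) {(\<lambda>\<omega>. f (\<pi> l \<omega>)) -` A \<inter> space M |A. A \<in> sets borel})
      (sigma_sets (space M) {\<xi> k -` A \<inter> space M |A. A \<in> sets borel})"
    unfolding indep_sets2_eq by (meson subsetD subset_trans)
  then show ?thesis unfolding indep_var_eq using \<xi>k f\<pi> by simp
qed

section \<open>Moments and independence of the noises\<close>

lemma iid_std_normal_moments:
  assumes "iid_std_normal M \<xi>"
  shows "integrable M (\<xi> k)" "integrable M (\<lambda>\<omega>. (\<xi> k \<omega>)\<^sup>2)"
    "expectation (\<xi> k) = 0" "expectation (\<lambda>\<omega>. (\<xi> k \<omega>)\<^sup>2) = 1"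
proof -
  have D: "distributed M lborel (\<xi> k) std_normal_density"
    using assms by (simp add: iid_std_normal_def)
  show "integrable M (\<xi> k)"
    using distributed_integrable[OF D, of "\<lambda>x. x"] integrable_std_normal_moment[of 1] by simp
  show "integrable M (\<lambda>\<omega>. (\<xi> k \<omega>)\<^sup>2)"
    using distributed_integrable[OF D, of "\<lambda>x. x\<^sup>2"] integrable_std_normal_moment[of 2] by simp
  show "expectation (\<xi> k) = 0"
    by (rule standard_normal_distributed_expectation[OF D])
  then show "expectation (\<lambda>\<omega>. (\<xi> k \<omega>)\<^sup>2) = 1"
    using standard_normal_distributed_variance[OF D] by simp
qed

lemma iid_std_normal_indep:
  assumes "iid_std_normal M \<xi>" "i \<noteq> j"
  shows "indep_var borel (\<xi> i) borel (\<xi> j)"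
  by (rule indep_vars_imp_indep_var) (use assms in \<open>simp_all add: iid_std_normal_def\<close>)

lemma expectation_reshuffled_plus_noise_square:
  fixes U :: "nat \<Rightarrow> (nat \<Rightarrow> nat) \<Rightarrow> real" and c :: "nat \<Rightarrow> real"
  assumes \<pi>: "random_reshuffling M N \<pi>" and \<xi>: "iid_std_normal M \<xi>"
    and indep: "noise_indep_of_permutations M N \<pi> \<xi>"
    and U: "\<And>l. (\<Sum>p\<in>perms N. U l p) = 0"
  shows "expectation (\<lambda>\<omega>. ((\<Sum>l<L. U l (\<pi> l \<omega>)) + (\<Sum>i<k. c i * \<xi> i \<omega>))\<^sup>2) =
    (\<Sum>l<L. (\<Sum>p\<in>perms N. (U l p)\<^sup>2) / fact N) + (\<Sum>i<k. (c i)\<^sup>2)"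
proof -
  \<comment> \<open>Epoch contributions and noise terms are put into one family over a disjoint sum
    of index sets, so that a single application of
    \<open>expectation_sum_uncorrelated_square\<close> covers all pairs.\<close>
  let ?U = "\<lambda>l \<omega>. U l (\<pi> l \<omega>)" and ?I = "{..<L} <+> {..<k}"
  define X where "X = case_sum ?U (\<lambda>i \<omega>. c i * \<xi> i \<omega>)"
  have X[simp]: "X (Inl l) = ?U l" "X (Inr i) = (\<lambda>\<omega>. c i * \<xi> i \<omega>)" for l i
    by (auto simp: X_def)
  note intU = random_reshuffling_integrable[OF \<pi>] and mom = iid_std_normal_moments[OF \<xi>]
  have EU: "expectation (?U l) = 0" for l
    by (simp add: random_reshuffling_expectation[OF \<pi>] U)
  \<comment> \<open>For distinct epochs independence and the zero mean apply. For
    \<open>l = l'\<close> only integrability is required, and the product is again a function of one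
    permutation.\<close>
  have UU: "integrable M (\<lambda>\<omega>. ?U l \<omega> * ?U l' \<omega>) \<and> (l \<noteq> l' \<longrightarrow> expectation (\<lambda>\<omega>. ?U l \<omega> * ?U l' \<omega>) = 0)" for l l'
    using expectation_mult_zero_mean[OF random_reshuffling_indep[OF \<pi>, of l l' U] intU intU EU]
      intU[of "\<lambda>p. U l p * U l p" l] by (cases "l = l'") auto
  have \<xi>\<xi>: "integrable M (\<lambda>\<omega>. \<xi> i \<omega> * \<xi> j \<omega>) \<and> (i \<noteq> j \<longrightarrow> expectation (\<lambda>\<omega>. \<xi> i \<omega> * \<xi> j \<omega>) = 0)" for i j
    using expectation_mult_zero_mean[OF iid_std_normal_indep[OF \<xi>] mom(1) mom(1) mom(3), of i j]
      mom(2)[of i] by (cases "i = j") (auto simp: power2_eq_square)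
  have U\<xi>: "integrable M (\<lambda>\<omega>. ?U l \<omega> * \<xi> i \<omega>) \<and> expectation (\<lambda>\<omega>. ?U l \<omega> * \<xi> i \<omega>) = 0" for l i
    using expectation_mult_zero_mean[OF random_reshuffling_noise_indep[OF \<pi> \<xi> indep, of "U l" l i] intU mom(1) mom(3)]
    by blast
  have XX: "integrable M (\<lambda>\<omega>. X s \<omega> * X t \<omega>) \<and> (s \<noteq> t \<longrightarrow> expectation (\<lambda>\<omega>. X s \<omega> * X t \<omega>) = 0)" for s t
  proof (cases s; cases t)
    fix l l' assume "s = Inl l" "t = Inl l'"
    then show ?thesis using UU[of l l'] by simp
  next
    fix l i assume "s = Inl l" "t = Inr i"
    then show ?thesis
      using U\<xi>[of l i] integrable_mult_right[of "c i" M "\<lambda>\<omega>. ?U l \<omega> * \<xi> i \<omega>"]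
        integral_mult_right_zero[of M "c i" "\<lambda>\<omega>. ?U l \<omega> * \<xi> i \<omega>"] by (simp add: ac_simps)
  next
    fix l i assume "s = Inr i" "t = Inl l"
    then show ?thesis
      using U\<xi>[of l i] integrable_mult_right[of "c i" M "\<lambda>\<omega>. ?U l \<omega> * \<xi> i \<omega>"]
        integral_mult_right_zero[of M "c i" "\<lambda>\<omega>. ?U l \<omega> * \<xi> i \<omega>"] by (simp add: ac_simps)
  next
    fix i j assume "s = Inr i" "t = Inr j"
    then show ?thesis
      using \<xi>\<xi>[of i j] integrable_mult_right[of "c i * c j" M "\<lambda>\<omega>. \<xi> i \<omega> * \<xi> j \<omega>"]
        integral_mult_right_zero[of M "c i * c j" "\<lambda>\<omega>. \<xi> i \<omega> * \<xi> j \<omega>"] by (simp add: ac_simps)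
  qed
  have "expectation (\<lambda>\<omega>. (\<Sum>s\<in>?I. X s \<omega>)\<^sup>2) = (\<Sum>s\<in>?I. expectation (\<lambda>\<omega>. (X s \<omega>)\<^sup>2))"
    using XX by (intro expectation_sum_uncorrelated_square) auto
  moreover have "(\<Sum>s\<in>?I. X s \<omega>) = (\<Sum>l<L. ?U l \<omega>) + (\<Sum>i<k. c i * \<xi> i \<omega>)" for \<omega>
    by (subst sum.Plus) (auto simp: o_def)
  moreover have "(\<Sum>s\<in>?I. expectation (\<lambda>\<omega>. (X s \<omega>)\<^sup>2)) =
      (\<Sum>l<L. expectation (\<lambda>\<omega>. (?U l \<omega>)\<^sup>2)) + (\<Sum>i<k. (c i)\<^sup>2)"
    by (subst sum.Plus) (auto simp: power_mult_distrib mom)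
  ultimately show ?thesis
    using random_reshuffling_expectation[OF \<pi>, of "\<lambda>p. (U l p)\<^sup>2" for l] by simp
qed

text \<open>\<open>K\<close> is obtained before the weights and ranges are chosen. This allows it to
  be expressed through \<open>V\<close> by one choice of weights and then used for the weights of
  the recursion.\<close>

lemma variance_batch_means_plus_noise:
  fixes y :: "nat \<Rightarrow> real"
  assumes \<pi>: "random_reshuffling M (n * R) \<pi>" and \<xi>: "iid_std_normal M \<xi>"
    and indep: "noise_indep_of_permutations M (n * R) \<pi> \<xi>"
    and n: "n \<ge> 1" and R: "R \<ge> 1"
  obtains K where "\<And>d c k L. variance (\<lambda>\<omega>. (\<Sum>i<L * R. d i * batch_mean n R y \<pi> i \<omega>) + (\<Sum>i<k. c i * \<xi> i \<omega>)) =
    K * (real R * (\<Sum>i<L * R. (d i)\<^sup>2) - (\<Sum>l<L. (\<Sum>b<R. d (l * R + b))\<^sup>2)) + (\<Sum>i<k. (c i)\<^sup>2)"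
proof -
  define N where "N = n * R"
  define ybar where "ybar = (\<Sum>i=1..N. y i) / real N"
  define z where "z i = y i - ybar" for i
  have N: "N \<ge> 1" using n R by (simp add: N_def)
  have z: "(\<Sum>i=1..N. z i) = 0"
    using N by (simp add: z_def sum_subtractf ybar_def)
  obtain K where K: "\<And>d. (\<Sum>p\<in>perms N. (\<Sum>b<R. d b * (1 / real n * (\<Sum>j=1..n. z (p (b * n + j)))))\<^sup>2) =
    K * (real R * (\<Sum>b<R. (d b)\<^sup>2) - (\<Sum>b<R. d b)\<^sup>2)"
    using sum_perms_weighted_blocks_square[OF z[unfolded N_def] n] unfolding N_def by blast
  note \<pi>N = \<pi>[folded N_def] and mom = iid_std_normal_moments[OF \<xi>]
  have "variance (\<lambda>\<omega>. (\<Sum>i<L * R. d i * batch_mean n R y \<pi> i \<omega>) + (\<Sum>i<k. c i * \<xi> i \<omega>)) =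
    K / fact N * (real R * (\<Sum>i<L * R. (d i)\<^sup>2) - (\<Sum>l<L. (\<Sum>b<R. d (l * R + b))\<^sup>2)) + (\<Sum>i<k. (c i)\<^sup>2)"
    (is "variance ?Y = ?rhs") for d c :: "nat \<Rightarrow> real" and k L
  proof -
    \<comment> \<open>The centered contribution of epoch \<open>l\<close> as a function of its
      permutation.\<close>
    define U where "U l p = (\<Sum>b<R. d (l * R + b) * (1 / real n * (\<Sum>j=1..n. z (p (b * n + j)))))" for l p
    have U0: "(\<Sum>p\<in>perms N. U l p) = 0" for l
    proof -
      have pos: "b * n + j \<in> {1..N}" if "b < R" "j \<in> {1..n}" for b j
      proof -
        have "Suc b * n \<le> R * n" using that by (intro mult_le_mono1) auto
        then show ?thesis using that by (auto simp: N_def ac_simps)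
      qed
      have "(\<Sum>p\<in>perms N. U l p) =
          (\<Sum>b<R. d (l * R + b) * (1 / real n * (\<Sum>j=1..n. \<Sum>p\<in>perms N. z (p (b * n + j)))))"
        unfolding U_def sum_distrib_left
        by (subst sum.swap, rule sum.cong[OF refl], subst sum.swap) simp
      also have "\<dots> = 0"
        by (intro sum.neutral) (auto simp: sum_perms_centered[OF z pos] simp del: One_nat_def)
      finally show ?thesis .
    qed
    \<comment> \<open>Centering replaces each batch mean by \<open>ybar\<close> plus a mean-zero
      part; the weighted \<open>ybar\<close> terms form a deterministic constant, so the variance is
      the second moment of the rest.\<close>
    have split: "?Y \<omega> = ybar * (\<Sum>i<L * R. d i) + ((\<Sum>l<L. U l (\<pi> l \<omega>)) + (\<Sum>i<k. c i * \<xi> i \<omega>))" for \<omega>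
    proof -
      have "batch_mean n R y \<pi> (l * R + b) \<omega> = ybar + 1 / real n * (\<Sum>j=1..n. z (\<pi> l \<omega> (b * n + j)))"
        if "b < R" for l b
      proof -
        have "(l * R + b) div R = l" "(l * R + b) mod R = b" using that by auto
        then show ?thesis using n
          by (simp add: batch_mean_def batch_index_def z_def sum_subtractf field_simps)
      qed
      then have "(\<Sum>i<L * R. d i * batch_mean n R y \<pi> i \<omega>) =
         (\<Sum>l<L. \<Sum>b<R. ybar * d (l * R + b) + d (l * R + b) * (1 / real n * (\<Sum>j=1..n. z (\<pi> l \<omega> (b * n + j)))))"
        unfolding sum_nat_blocks by (intro sum.cong refl) (simp add: algebra_simps)
      also have "\<dots> = ybar * (\<Sum>i<L * R. d i) + (\<Sum>l<L. U l (\<pi> l \<omega>))"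
        unfolding sum_nat_blocks by (simp only: sum.distrib U_def sum_distrib_left)
      finally show ?thesis by simp
    qed
    have "expectation (\<lambda>\<omega>. (\<Sum>l<L. U l (\<pi> l \<omega>)) + (\<Sum>i<k. c i * \<xi> i \<omega>)) = 0"
      by (simp add: random_reshuffling_integrable[OF \<pi>N] random_reshuffling_expectation[OF \<pi>N] U0 mom)
    then have "expectation ?Y = ybar * (\<Sum>i<L * R. d i)"
      unfolding split by (subst Bochner_Integration.integral_add)
        (auto simp: prob_space random_reshuffling_integrable[OF \<pi>N] mom)
    then have "variance ?Y = expectation (\<lambda>\<omega>. ((\<Sum>l<L. U l (\<pi> l \<omega>)) + (\<Sum>i<k. c i * \<xi> i \<omega>))\<^sup>2)"
      unfolding split by simp
    also have "\<dots> = (\<Sum>l<L. (\<Sum>p\<in>perms N. (U l p)\<^sup>2) / fact N) + (\<Sum>i<k. (c i)\<^sup>2)"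
      by (rule expectation_reshuffled_plus_noise_square[OF \<pi>N \<xi> indep[folded N_def] U0])
    \<comment> \<open>Averaging over the \<open>fact N\<close> equally likely permutations turns the
      constant of the permutation sum into \<open>K / fact N\<close>.\<close>
    also have "(\<Sum>l<L. (\<Sum>p\<in>perms N. (U l p)\<^sup>2) / fact N) =
        (\<Sum>l<L. K / fact N * (real R * (\<Sum>b<R. (d (l * R + b))\<^sup>2) - (\<Sum>b<R. d (l * R + b))\<^sup>2))"
      unfolding U_def by (subst K) simp
    also have "\<dots> = K / fact N * (real R * (\<Sum>i<L * R. (d i)\<^sup>2) - (\<Sum>l<L. (\<Sum>b<R. d (l * R + b))\<^sup>2))"
      unfolding sum_nat_blocks by (simp only: sum_subtractf sum_distrib_left right_diff_distrib)
    finally show ?thesis .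
  qed
  then show ?thesis by (rule that)
qed

end

section \<open>Solution of the linear recursion\<close>

lemma linear_recursion_solution:
  fixes x u :: "nat \<Rightarrow> real"
  assumes "x 0 = 0" "\<And>k. x (Suc k) = a * x k + u k"
  shows "x k = (\<Sum>i<k. a ^ (k - Suc i) * u i)"
proof (induction k)
  case (Suc k)
  have "a * a ^ (k - Suc i) = a ^ (k - i)" if "i < k" for i
    using power_Suc[of a "k - Suc i"] that by (simp only: Suc_diff_Suc)
  then have "a * (\<Sum>i<k. a ^ (k - Suc i) * u i) = (\<Sum>i<k. a ^ (k - i) * u i)"
    unfolding sum_distrib_left by (intro sum.cong refl) (metis lessThan_iff mult.assoc)
  then show ?case by (simp only: assms(2) Suc.IH) simp
qed (simp add: assms(1))

subsection \<open>Geometric weights\<close>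

lemma sum_power_diff_Suc:
  fixes a :: real
  assumes "a \<noteq> 1"
  shows "(\<Sum>i<k. a ^ (k - Suc i)) = (1 - a ^ k) / (1 - a)"
  using one_diff_power_eq'[of a k] assms by (simp add: field_simps)

text \<open>Only the first \<open>r\<close> batches of the unfinished epoch have been used; the
  later ones get weight zero, so that this epoch also counts as \<open>R\<close> batches.\<close>

lemma last_epoch_weights:
  fixes h :: real
  assumes "r \<le> R"
  shows "(\<Sum>b<R. if b < r then h * (1 - h) ^ (r - Suc b) else 0) = 1 - (1 - h) ^ r"
proof -
  have "(\<Sum>b<R. if b < r then h * (1 - h) ^ (r - Suc b) else 0) = (\<Sum>b<r. h * (1 - h) ^ (r - Suc b))"
    using assms by (intro sum.mono_neutral_cong_right) auto
  then show ?thesis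
    using one_diff_power_eq'[of "1 - h" r] by (simp add: sum_distrib_left)
qed

text \<open>The exponent splits into \<open>R\<close> for each full epoch after \<open>l\<close>,
  the \<open>r\<close> steps of the unfinished epoch, and the \<open>R - Suc b\<close> steps left in
  epoch \<open>l\<close>. Only the last part depends on \<open>b\<close>, and its geometric sum has
  the prefactor \<open>h\<close>, which cancels the denominator.\<close>

lemma full_epoch_weights:
  fixes h :: real
  assumes "l < L"
  shows "(\<Sum>b<R. h * (1 - h) ^ (L * R + r - Suc (l * R + b))) =
    (1 - h) ^ r * (1 - (1 - h) ^ R) * ((1 - h) ^ R) ^ (L - Suc l)"
proof -
  have "(1 - h) ^ (L * R + r - Suc (l * R + b)) = ((1 - h) ^ R) ^ (L - Suc l) * (1 - h) ^ r * (1 - h) ^ (R - Suc b)"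
    if b: "b < R" for b
  proof -
    obtain k where "L = Suc (l + k)" using less_imp_Suc_add[OF assms] by auto
    moreover obtain c where "R = Suc (b + c)" using less_imp_Suc_add[OF b] by auto
    ultimately have "L * R + r - Suc (l * R + b) = R * (L - Suc l) + r + (R - Suc b)"
      by (simp add: algebra_simps)
    then show ?thesis by (simp add: power_add power_mult)
  qed
  then have "(\<Sum>b<R. h * (1 - h) ^ (L * R + r - Suc (l * R + b))) =
      ((1 - h) ^ R) ^ (L - Suc l) * (1 - h) ^ r * (h * (\<Sum>b<R. (1 - h) ^ (R - Suc b)))"
    by (simp add: sum_distrib_left ac_simps)
  then show ?thesis
    using one_diff_power_eq'[of "1 - h" R] by simp
qed

section \<open>Exact variance after finitely many steps and its limit\<close>

theorem mainTheorem2: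
  fixes M :: "'a measure"
    and N n R r m :: nat
    and y :: "nat \<Rightarrow> real"
    and \<sigma> h V :: real
    and \<pi> :: "nat \<Rightarrow> 'a \<Rightarrow> nat \<Rightarrow> nat"
    and \<xi> :: "nat \<Rightarrow> 'a \<Rightarrow> real"
    and x :: "nat \<Rightarrow> 'a \<Rightarrow> real"
  assumes "prob_space M"
    and "n \<ge> 1" and "R \<ge> 2" and "N = n * R"
    and "\<sigma> > 0" and "0 < h" and "h < 2"
    and "random_reshuffling M N \<pi>"
    and "iid_std_normal M \<xi>"
    and "noise_indep_of_permutations M N \<pi> \<xi>"
    and "\<And>\<omega>. \<omega> \<in> space M \<Longrightarrow> x 0 \<omega> = 0"
    and "\<And>k \<omega>. \<omega> \<in> space M \<Longrightarrow>
           x (Suc k) \<omega> = (1 - h) * x k \<omega> + h * batch_mean n R y \<pi> k \<omega>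
                         + \<sigma> * sqrt (2 * h / real N) * \<xi> k \<omega>"
    and "V = prob_space.variance M (batch_mean n R y \<pi> m)"
    and "r < R"
  shows "\<exists>Vinf. (\<lambda>ne. prob_space.variance M (x (ne * R + r))) \<longlonglongrightarrow> Vinf \<and>
     (Vinf - \<sigma>\<^sup>2 / real N) / (\<sigma>\<^sup>2 / real N) =
       real N * V / (\<sigma>\<^sup>2 * (real R - 1)) *
         (real R * h / (2 - h) -
           ((1 - h) ^ (2 * r) * (1 - (1 - h) ^ R)\<^sup>2 / (1 - (1 - h) ^ (2 * R))
            + (1 - (1 - h) ^ r)\<^sup>2))
       + 2 / (2 - h) - 1"
proof -
  interpret prob_space M by fact
  note n = \<open>n \<ge> 1\<close> and R = \<open>R \<ge> 2\<close> and N = \<open>N = n * R\<close> and \<sigma> = \<open>\<sigma> > 0\<close> and h = \<open>0 < h\<close> \<open>h < 2\<close>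
    and r = \<open>r < R\<close>
  define a where "a = 1 - h"
  define s where "s = \<sigma> * sqrt (2 * h / real N)"
  have a: "\<bar>a\<bar> < 1" "a\<^sup>2 < 1" using h by (auto simp: a_def abs_square_less_1)
  have Npos: "real N > 0" using n R N by simp
  obtain K where K: "\<And>d c k L. variance (\<lambda>\<omega>. (\<Sum>i<L * R. d i * batch_mean n R y \<pi> i \<omega>) + (\<Sum>i<k. c i * \<xi> i \<omega>)) =
    K * (real R * (\<Sum>i<L * R. (d i)\<^sup>2) - (\<Sum>l<L. (\<Sum>b<R. d (l * R + b))\<^sup>2)) + (\<Sum>i<k. (c i)\<^sup>2)"
    using variance_batch_means_plus_noise[of n R \<pi> \<xi> y] assms by auto
  \<comment> \<open>The variance formula is applied with weight one on batch \<open>m\<close> and no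
    noise. Both the sum of squares and the sum of squared epoch sums are then 1, which leaves
    \<open>K * (R - 1)\<close>.\<close>
  have V: "V = K * (real R - 1)"
  proof -
    let ?L = "Suc (m div R)" and ?d = "\<lambda>i. of_bool (i = m) :: real"
    have m: "m < ?L * R" using R by (metis dividend_less_div_times mult.commute mult_Suc_right add.commute less_le_trans zero_less_numeral)
    have "V = variance (\<lambda>\<omega>. (\<Sum>i<?L * R. ?d i * batch_mean n R y \<pi> i \<omega>) + (\<Sum>i<0. 0 * \<xi> i \<omega>))"
      using m by (simp add: assms(13) of_bool_def if_distrib[of "\<lambda>c. c * _"] cong: if_cong)
    also have "\<dots> = K * (real R * (\<Sum>i<?L * R. (?d i)\<^sup>2) - (\<Sum>l<?L. (\<Sum>b<R. ?d (l * R + b))\<^sup>2))"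
      by (subst K) simp
    also have "(\<Sum>i<?L * R. (?d i)\<^sup>2) = 1"
      using m by (simp add: of_bool_def if_distrib[of "\<lambda>c. c\<^sup>2"] cong: if_cong)
    also have "(\<Sum>l<?L. (\<Sum>b<R. ?d (l * R + b))\<^sup>2) = 1"
    proof -
      have "(\<Sum>b<R. ?d (l * R + b)) = of_bool (l = m div R)" for l
      proof -
        have "l * R + b = m \<longleftrightarrow> l = m div R \<and> b = m mod R" if "b < R" for b
          using that by auto
        then have "(\<Sum>b<R. ?d (l * R + b)) = (\<Sum>b<R. of_bool (l = m div R) * (if b = m mod R then 1 else 0))"
          by (intro sum.cong) auto
        then show ?thesis using R by (simp flip: sum_distrib_left)
      qed
      then show ?thesis
        by (simp add: of_bool_def if_distrib[of "\<lambda>c. c\<^sup>2"] cong: if_cong)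
    qed
    finally show ?thesis by simp
  qed
  define q where "q = a ^ (2 * R)"
  have q: "\<bar>q\<bar> < 1"
    using a R power_less_one_iff[of "\<bar>a\<bar>" "2 * R"] by (simp add: q_def power_abs)
  \<comment> \<open>The exact variance after \<open>ne\<close> full epochs and \<open>r\<close>
    steps. The first fraction comes from the squares of all weights, the second from the weight sums
    of the full epochs, and \<open>(1 - a ^ r)\<^sup>2\<close> from the unfinished epoch.\<close>
  define F where "F ne = K * (real R * h\<^sup>2 * ((1 - q ^ ne * a ^ (2 * r)) / (1 - a\<^sup>2)) -
      (a ^ (2 * r) * (1 - a ^ R)\<^sup>2 * ((1 - q ^ ne) / (1 - q)) + (1 - a ^ r)\<^sup>2)) +
      s\<^sup>2 * ((1 - q ^ ne * a ^ (2 * r)) / (1 - a\<^sup>2))" for ne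
  have var: "variance (x (ne * R + r)) = F ne" for ne
  proof -
    define k where "k = ne * R + r"
    \<comment> \<open>The weights are extended by zero up to \<open>Suc ne * R\<close>, because the
      variance formula needs a whole number of epochs.\<close>
    define d where "d i = (if i < k then h * a ^ (k - Suc i) else 0)" for i
    have k: "k \<le> Suc ne * R" using r by (simp add: k_def)
    have "x k \<omega> = (\<Sum>i<Suc ne * R. d i * batch_mean n R y \<pi> i \<omega>) + (\<Sum>i<k. s * a ^ (k - Suc i) * \<xi> i \<omega>)"
      if \<omega>: "\<omega> \<in> space M" for \<omega>
    proof -
      have "x k \<omega> = (\<Sum>i<k. a ^ (k - Suc i) * (h * batch_mean n R y \<pi> i \<omega> + s * \<xi> i \<omega>))"
        by (rule linear_recursion_solution) (auto simp: assms(11,12) \<omega> a_def s_def)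
      also have "\<dots> = (\<Sum>i<k. d i * batch_mean n R y \<pi> i \<omega>) + (\<Sum>i<k. s * a ^ (k - Suc i) * \<xi> i \<omega>)"
        by (simp add: d_def sum.distrib algebra_simps)
      also have "(\<Sum>i<k. d i * batch_mean n R y \<pi> i \<omega>) = (\<Sum>i<Suc ne * R. d i * batch_mean n R y \<pi> i \<omega>)"
        using k by (intro sum.mono_neutral_left) (auto simp: d_def)
      finally show ?thesis .
    qed
    then have "variance (x k) = variance (\<lambda>\<omega>. (\<Sum>i<Suc ne * R. d i * batch_mean n R y \<pi> i \<omega>) + (\<Sum>i<k. s * a ^ (k - Suc i) * \<xi> i \<omega>))"
      by (simp cong: Bochner_Integration.integral_cong)
    also have "\<dots> = K * (real R * (\<Sum>i<Suc ne * R. (d i)\<^sup>2) - (\<Sum>l<Suc ne. (\<Sum>b<R. d (l * R + b))\<^sup>2)) + (\<Sum>i<k. (s * a ^ (k - Suc i))\<^sup>2)"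
      by (rule K)
    \<comment> \<open>Stated for any prefactor \<open>c\<close>: it evaluates the noise weights with
      \<open>c = s\<close> and the squared batch weights with \<open>c = h\<close>.\<close>
    also have geo: "(\<Sum>i<k. (c * a ^ (k - Suc i))\<^sup>2) = c\<^sup>2 * ((1 - q ^ ne * a ^ (2 * r)) / (1 - a\<^sup>2))" for c
    proof -
      have "(\<Sum>i<k. (c * a ^ (k - Suc i))\<^sup>2) = c\<^sup>2 * (\<Sum>i<k. (a\<^sup>2) ^ (k - Suc i))"
        unfolding power_mult_distrib sum_distrib_left by (simp add: mult.commute flip: power_mult)
      also have "(\<Sum>i<k. (a\<^sup>2) ^ (k - Suc i)) = (1 - (a\<^sup>2) ^ k) / (1 - a\<^sup>2)"
        using a by (intro sum_power_diff_Suc) auto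
      also have "(a\<^sup>2) ^ k = q ^ ne * a ^ (2 * r)"
        by (simp add: k_def q_def algebra_simps flip: power_mult power_add)
      finally show ?thesis .
    qed
    also have "(\<Sum>i<Suc ne * R. (d i)\<^sup>2) = (\<Sum>i<k. (h * a ^ (k - Suc i))\<^sup>2)"
      using k by (intro sum.mono_neutral_cong_right) (auto simp: d_def)
    also note geo
    also have "(\<Sum>l<Suc ne. (\<Sum>b<R. d (l * R + b))\<^sup>2) =
        a ^ (2 * r) * (1 - a ^ R)\<^sup>2 * ((1 - q ^ ne) / (1 - q)) + (1 - a ^ r)\<^sup>2"
    proof -
      have "(\<Sum>b<R. d (ne * R + b)) = (\<Sum>b<R. if b < r then h * (1 - h) ^ (r - Suc b) else 0)"
        by (intro sum.cong) (auto simp: d_def k_def a_def)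
      then have last: "(\<Sum>b<R. d (ne * R + b)) = 1 - a ^ r"
        using last_epoch_weights[of r R h] r by (simp add: a_def)
      have full: "(\<Sum>b<R. d (l * R + b))\<^sup>2 = a ^ (2 * r) * (1 - a ^ R)\<^sup>2 * q ^ (ne - Suc l)" if l: "l < ne" for l
      proof -
        have "l * R + b < k" if "b < R" for b
        proof -
          have "Suc l * R \<le> ne * R" using l by (intro mult_le_mono1) auto
          then show ?thesis using that by (simp add: k_def)
        qed
        then have "(\<Sum>b<R. d (l * R + b)) = (\<Sum>b<R. h * (1 - h) ^ (ne * R + r - Suc (l * R + b)))"
          by (intro sum.cong) (auto simp: d_def k_def a_def)
        also have "\<dots> = a ^ r * (1 - a ^ R) * (a ^ R) ^ (ne - Suc l)"
          using full_epoch_weights[OF l, of h R r] by (simp add: a_def)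
        finally have "(\<Sum>b<R. d (l * R + b)) = a ^ r * (1 - a ^ R) * (a ^ R) ^ (ne - Suc l)" .
        moreover have "((a ^ R) ^ e)\<^sup>2 = q ^ e" "(a ^ r)\<^sup>2 = a ^ (2 * r)" for e
          by (simp_all add: q_def ac_simps flip: power_mult)
        ultimately show ?thesis by (simp only: power_mult_distrib)
      qed
      have "(\<Sum>l<ne. (\<Sum>b<R. d (l * R + b))\<^sup>2) = a ^ (2 * r) * (1 - a ^ R)\<^sup>2 * (\<Sum>l<ne. q ^ (ne - Suc l))"
        by (simp add: full sum_distrib_left)
      also have "(\<Sum>l<ne. q ^ (ne - Suc l)) = (1 - q ^ ne) / (1 - q)"
        using q by (intro sum_power_diff_Suc) auto
      finally show ?thesis by (simp add: last)
    qed
    finally show ?thesis by (simp add: F_def k_def mult.assoc)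
  qed
  define P where "P = a ^ (2 * r) * (1 - a ^ R)\<^sup>2 / (1 - q) + (1 - a ^ r)\<^sup>2"
  define Vinf where "Vinf = K * (real R * h\<^sup>2 / (1 - a\<^sup>2) - P) + s\<^sup>2 / (1 - a\<^sup>2)"
  have "(\<lambda>ne. q ^ ne) \<longlonglongrightarrow> 0"
    using q by (intro LIMSEQ_abs_realpow_zero2)
  \<comment> \<open>The limit is first written as \<open>F\<close> with 0 in place of
    \<open>q ^ ne\<close>, which follows the structure of \<open>F\<close> term by term.\<close>
  then have "F \<longlonglongrightarrow> K * (real R * h\<^sup>2 * ((1 - 0 * a ^ (2 * r)) / (1 - a\<^sup>2)) -
      (a ^ (2 * r) * (1 - a ^ R)\<^sup>2 * ((1 - 0) / (1 - q)) + (1 - a ^ r)\<^sup>2)) +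
      s\<^sup>2 * ((1 - 0 * a ^ (2 * r)) / (1 - a\<^sup>2))"
    unfolding F_def using a q by (intro tendsto_intros) auto
  then have lim: "(\<lambda>ne. variance (x (ne * R + r))) \<longlonglongrightarrow> Vinf"
    by (simp add: var Vinf_def P_def)
  \<comment> \<open>This factorization produces the denominators \<open>2 - h\<close>: one factor
    \<open>h\<close> cancels against \<open>h\<^sup>2\<close> in the batch part and against the
    \<open>h\<close> of \<open>s\<^sup>2\<close> in the noise part.\<close>
  have "1 - a\<^sup>2 = h * (2 - h)" by (simp add: a_def power2_eq_square algebra_simps)
  moreover have "s\<^sup>2 = \<sigma>\<^sup>2 * (2 * h / real N)"
    using h Npos by (simp add: s_def power_mult_distrib)
  moreover have "K = V / (real R - 1)" using V R by simp
  ultimately have "Vinf = V / (real R - 1) * (real R * h / (2 - h) - P) + \<sigma>\<^sup>2 / real N * (2 / (2 - h))"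
    using h by (simp add: Vinf_def power2_eq_square)
  \<comment> \<open>The relative error with \<open>t\<close> the target variance, \<open>A\<close>
    the batch part of \<open>Vinf\<close>, and \<open>t * c\<close> its noise part.\<close>
  moreover have rel: "(A + t * c - t) / t = A / t + c - 1" if "t \<noteq> 0" for A t c :: real
    using that by (simp add: field_simps)
  moreover have "\<sigma>\<^sup>2 / real N \<noteq> 0" using \<sigma> Npos by simp
  ultimately have "(Vinf - \<sigma>\<^sup>2 / real N) / (\<sigma>\<^sup>2 / real N) =
      V / (real R - 1) * (real R * h / (2 - h) - P) / (\<sigma>\<^sup>2 / real N) + 2 / (2 - h) - 1"
    by (simp only: rel)
  then have "(Vinf - \<sigma>\<^sup>2 / real N) / (\<sigma>\<^sup>2 / real N) =
      real N * V / (\<sigma>\<^sup>2 * (real R - 1)) * (real R * h / (2 - h) - P) + 2 / (2 - h) - 1"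
    by (simp add: ac_simps)
  with lim show ?thesis
    unfolding P_def q_def a_def by blast
qed

end
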